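(* Let $\mathbb{X}$ be a real reflexive Banach space and $\mathbb{Y}$ any real Banach space. Let $\mathcal{Z}$ be a finite-dimensional subspace of $\mathbb{K}(\mathbb{X},\mathbb{Y})$ and let $T\in\mathbb{K}(\mathbb{X},\mathbb{Y})\setminus\mathcal{Z}$. Assume further that for any $\lambda\in\mathbb{R}$ and for any $A\in\mathcal{Z}$, $M_{T+\lambda A}=D_{\lambda,A}\cup(-D_{\lambda,A})$, where $D_{\lambda,A}$ is a non-empty connected subset of $S_{\mathbb{X}}$. Let $\mathcal{O}$ denote the collection of all s.i.p. on $\mathbb{Y}$. Then there exists $A_0\in\mathcal{Z}$ such that $$\operatorname{dist}(T,\mathcal{Z})=\sup\{[Tx,y]:x\in S_{\mathbb{X}},\ y\in S_{\mathbb{Y}},\ [\cdot,\cdot]\in\mathcal{O},\ [A_0x,y]=0\}.$$ Moreover, $A_0$ is the best approximation to $T$ in $\mathcal{Z}$.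
   Context: All normed spaces are real; $S_{\mathbb{X}}=\{x\in\mathbb{X}:\|x\|=1\}$ and similarly $S_{\mathbb{Y}}$. $\mathbb{K}(\mathbb{X},\mathbb{Y})$ is the space of compact linear operators from $\mathbb{X}$ to $\mathbb{Y}$ with the operator norm, and $\operatorname{dist}(T,\mathcal{Z})=\inf_{B\in\mathcal{Z}}\|T-B\|$; a best approximation to $T$ in $\mathcal{Z}$ is an element $B\in\mathcal{Z}$ with $\|T-B\|=\operatorname{dist}(T,\mathcal{Z})$. For a bounded linear operator $S:\mathbb{X}\to\mathbb{Y}$, $M_S=\{x\in S_{\mathbb{X}}:\|Sx\|=\|S\|\}$. A semi-inner-product (s.i.p.) on a real normed space $\mathbb{Y}$ is a function $[\cdot,\cdot]:\mathbb{Y}\times\mathbb{Y}\to\mathbb{R}$ such that for all $\alpha,\beta\in\mathbb{R}$ and $x,y,z\in\mathbb{Y}$: (a) $[\alpha x+\beta y,z]=\alpha[x,z]+\beta[y,z]$; (b) $[x,x]>0$ whenever $x\ne 0$; (c) $|[x,y]|^2\le[x,x][y,y]$; (d) $[x,\alpha y]=\alpha[x,y]$. Every s.i.p. is assumed compatible with the norm: $[x,x]=\|x\|^2$ for all $x$. In the supremum, the same s.i.p. is used in $[Tx,y]$ and $[A_0x,y]$. *)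

theory Defs
  imports "HOL-Analysis.Analysis"
begin

text \<open>
  Bounded linear operators are elements of the type \<open>'a \<Rightarrow>\<^sub>L 'b\<close>, whose norm is the operator
  norm. Consequently \<open>dist T B\<close> is the norm of \<open>T - B\<close>, and \<open>infdist T Z\<close> is the infimum of
  these distances over \<open>B \<in> Z\<close> as soon as \<open>Z\<close> is nonempty, in particular for a subspace.
\<close>

text \<open>
  The canonical embedding into the bidual is onto. The type argument carries the space, since
  the Banach space is the whole type.
\<close>

definition reflexive_space :: "'a::real_normed_vector itself \<Rightarrow> bool" where
  "reflexive_space _ \<longleftrightarrow>
     (\<forall>\<phi> :: ('a \<Rightarrow>\<^sub>L real) \<Rightarrow>\<^sub>L real. \<exists>x::'a. \<forall>f. blinfun_apply \<phi> f = blinfun_apply f x)"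

definition compact_operators :: "('a::real_normed_vector \<Rightarrow>\<^sub>L 'b::real_normed_vector) set" where
  "compact_operators = {T. compact (closure (blinfun_apply T ` cball 0 1))}"

definition finite_dim_subspace :: "'a::real_vector set \<Rightarrow> bool" where
  "finite_dim_subspace Z \<longleftrightarrow> subspace Z \<and> (\<exists>B. finite B \<and> span B = Z)"

definition norm_attainment_set ::
    "('a::real_normed_vector \<Rightarrow>\<^sub>L 'b::real_normed_vector) \<Rightarrow> 'a set" where
  "norm_attainment_set S = {x \<in> sphere 0 1. norm (blinfun_apply S x) = norm S}"

definition best_approximation :: "'a::metric_space set \<Rightarrow> 'a \<Rightarrow> 'a \<Rightarrow> bool" where
  "best_approximation Z T B \<longleftrightarrow> B \<in> Z \<and> dist T B = infdist T Z"

text \<open>Only semi-inner-products compatible with the norm are considered (last conjunct).\<close>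

definition semi_inner_products :: "('b::real_normed_vector \<Rightarrow> 'b \<Rightarrow> real) set" where
  "semi_inner_products = {p.
     (\<forall>\<alpha> \<beta> x y z. p (\<alpha> *\<^sub>R x + \<beta> *\<^sub>R y) z = \<alpha> * p x z + \<beta> * p y z) \<and>
     (\<forall>x. x \<noteq> 0 \<longrightarrow> p x x > 0) \<and>
     (\<forall>x y. \<bar>p x y\<bar>\<^sup>2 \<le> p x x * p y y) \<and>
     (\<forall>\<alpha> x y. p x (\<alpha> *\<^sub>R y) = \<alpha> * p x y) \<and>
     (\<forall>x. p x x = (norm x)\<^sup>2)}"

end

theory Submission
  imports Defs
begin

text \<open>
  Let \<open>A\<^sub>0\<close> be a best approximation and \<open>S = T - A\<^sub>0\<close>. If \<open>[A\<^sub>0 x, y] = 0\<close> then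
  \<open>[T x, y] = [S x, y] \<le> \<parallel>S\<parallel>\<close>, so only attainment is at stake. Since \<open>S\<close> is Birkhoff-James
  orthogonal to \<open>A\<^sub>0\<close>, norm attaining points of \<open>S \<plusminus> A\<^sub>0 / n\<close> accumulate (by reflexivity and
  compactness) at norm attaining points \<open>x\<close> of \<open>S\<close> at which \<open>\<parallel>S x + \<lambda> A\<^sub>0 x\<parallel> \<ge> \<parallel>S x\<parallel>\<close> for all
  \<open>\<lambda> \<ge> 0\<close>, respectively for all \<open>\<lambda> \<le> 0\<close>. These two kinds of points form closed symmetric sets
  covering the norm attainment set, so by connectedness they share a point \<open>x\<close>. At this point
  Hahn-Banach gives a support functional of \<open>S x\<close> vanishing at \<open>A\<^sub>0 x\<close>, from which the required
  semi-inner-product is built.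
\<close>

section \<open>Hahn-Banach via minimal sublinear functionals\<close>

text \<open>Homogeneity is asked only as an inequality for positive factors: using it at
  \<open>1/t\<close> as well gives equality, so each construction has just one direction to
  verify.\<close>

definition sublinear :: "('v::real_vector \<Rightarrow> real) \<Rightarrow> bool" where
  "sublinear q \<longleftrightarrow> (\<forall>v w. q (v + w) \<le> q v + q w) \<and> (\<forall>t v. 0 < t \<longrightarrow> q (t *\<^sub>R v) \<le> t * q v)"

lemma sublinear_add: "sublinear q \<Longrightarrow> q (v + w) \<le> q v + q w"
  unfolding sublinear_def by blast

lemma sublinear_scale:
  assumes "sublinear q" "0 < t"
  shows "q (t *\<^sub>R v) = t * q v"
proof (rule antisym)
  show "q (t *\<^sub>R v) \<le> t * q v"
    using assms unfolding sublinear_def by blast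
  have "q ((1/t) *\<^sub>R (t *\<^sub>R v)) \<le> (1/t) * q (t *\<^sub>R v)"
    using assms unfolding sublinear_def by (metis zero_less_divide_1_iff)
  then show "t * q v \<le> q (t *\<^sub>R v)"
    using assms(2) by (simp add: field_simps)
qed

lemma sublinear_zero: "sublinear q \<Longrightarrow> q 0 = 0"
  using sublinear_scale[of q 2 0] by simp

lemma sublinear_minus: "sublinear q \<Longrightarrow> - q (- v) \<le> q v"
  using sublinear_add[of q v "- v"] sublinear_zero[of q] by simp

text \<open>Common core of four constructions below: tilting, infima of chains, the distance to a
  line, and the upper limit along a sequence. Each is a pointwise infimum of value sets compatible
  with sums and positive multiples.\<close>

lemma sublinear_Inf:
  fixes R :: "'v::real_vector \<Rightarrow> real set"
  assumes ne: "\<And>v. R v \<noteq> {}" and bdd: "\<And>v. bdd_below (R v)"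
    and add: "\<And>v w r s. r \<in> R v \<Longrightarrow> s \<in> R w \<Longrightarrow> \<exists>u\<in>R (v + w). u \<le> r + s"
    and scale: "\<And>t v r. 0 < t \<Longrightarrow> r \<in> R v \<Longrightarrow> \<exists>u\<in>R (t *\<^sub>R v). u \<le> t * r"
  shows "sublinear (\<lambda>v. Inf (R v))"
  unfolding sublinear_def
proof (intro conjI allI impI)
  fix v w
  have *: "Inf (R (v + w)) \<le> r + s" if "r \<in> R v" "s \<in> R w" for r s
    using add[OF that] cInf_lower[OF _ bdd] by (meson order_trans)
  have "Inf (R (v + w)) - s \<le> Inf (R v)" if "s \<in> R w" for s
    using * that by (intro cInf_greatest[OF ne]) (simp add: algebra_simps)
  then have "Inf (R (v + w)) - Inf (R v) \<le> Inf (R w)"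
    by (intro cInf_greatest[OF ne]) (simp add: algebra_simps)
  then show "Inf (R (v + w)) \<le> Inf (R v) + Inf (R w)" by simp
next
  fix t :: real and v assume t: "0 < t"
  have "Inf (R (t *\<^sub>R v)) / t \<le> r" if "r \<in> R v" for r
  proof -
    have "Inf (R (t *\<^sub>R v)) \<le> t * r"
      using scale[OF t that] cInf_lower[OF _ bdd] by (meson order_trans)
    then show ?thesis using t by (simp add: field_simps)
  qed
  then have "Inf (R (t *\<^sub>R v)) / t \<le> Inf (R v)"
    by (intro cInf_greatest[OF ne])
  then show "Inf (R (t *\<^sub>R v)) \<le> t * Inf (R v)"
    using t by (simp add: field_simps)
qed

text \<open>Take for \<open>q'\<close> the infimum over \<open>t\<close> at least 0 of
  \<open>q (v + t *\<^sub>R v\<^sub>0) - t * q v\<^sub>0\<close>. The choice \<open>t = 0\<close>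
  bounds it by \<open>q\<close>, and \<open>t = 1\<close> at \<open>- v\<^sub>0\<close> gives the
  last claim. This forces minimal sublinear functionals to be odd.\<close>

lemma sublinear_tilt:
  assumes q: "sublinear q"
  obtains q' where "sublinear q'" "q' \<le> q" "q' (- v\<^sub>0) \<le> - q v\<^sub>0"
proof -
  define R where "R v = {q (v + t *\<^sub>R v\<^sub>0) - t * q v\<^sub>0 | t. 0 \<le> t}" for v
  have scale0: "q (t *\<^sub>R v) = t * q v" if "0 \<le> t" for t v
    using that sublinear_scale[OF q] sublinear_zero[OF q] by (cases "t = 0") auto
  have ne: "R v \<noteq> {}" for v
    unfolding R_def by auto
  have bdd: "bdd_below (R v)" for v
  \<comment> \<open>The infimum is finite because \<open>t * q v\<^sub>0\<close> equals
    \<open>q (t *\<^sub>R v\<^sub>0)\<close>, and subadditivity splits off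
    \<open>- v\<close>.\<close>
  proof (rule bdd_belowI[of _ "- q (- v)"])
    fix r assume "r \<in> R v"
    then obtain t where t: "0 \<le> t" "r = q (v + t *\<^sub>R v\<^sub>0) - t * q v\<^sub>0"
      unfolding R_def by blast
    have "q (t *\<^sub>R v\<^sub>0) \<le> q (v + t *\<^sub>R v\<^sub>0) + q (- v)"
      using sublinear_add[OF q, of "v + t *\<^sub>R v\<^sub>0" "- v"] by simp
    then show "- q (- v) \<le> r" using t scale0 by simp
  qed
  have "sublinear (\<lambda>v. Inf (R v))"
  proof (rule sublinear_Inf[OF ne bdd])
    fix v w r s assume "r \<in> R v" "s \<in> R w"
    then obtain t u where tu: "0 \<le> t" "0 \<le> u" "r = q (v + t *\<^sub>R v\<^sub>0) - t * q v\<^sub>0"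
      "s = q (w + u *\<^sub>R v\<^sub>0) - u * q v\<^sub>0"
      unfolding R_def by blast
    have "q (v + w + (t + u) *\<^sub>R v\<^sub>0) \<le> q (v + t *\<^sub>R v\<^sub>0) + q (w + u *\<^sub>R v\<^sub>0)"
      using sublinear_add[OF q, of "v + t *\<^sub>R v\<^sub>0" "w + u *\<^sub>R v\<^sub>0"] by (simp add: algebra_simps)
    then have "q (v + w + (t + u) *\<^sub>R v\<^sub>0) - (t + u) * q v\<^sub>0 \<le> r + s"
      using tu by (simp add: algebra_simps)
    then show "\<exists>z\<in>R (v + w). z \<le> r + s"
      unfolding R_def using tu by (intro bexI) (auto intro!: exI[of _ "t + u"])
  next
    fix c :: real and v r assume c: "0 < c" and "r \<in> R v"
    then obtain t where t: "0 \<le> t" "r = q (v + t *\<^sub>R v\<^sub>0) - t * q v\<^sub>0"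
      unfolding R_def by blast
    have "q (c *\<^sub>R v + (c * t) *\<^sub>R v\<^sub>0) = c * q (v + t *\<^sub>R v\<^sub>0)"
      using sublinear_scale[OF q c, of "v + t *\<^sub>R v\<^sub>0"] by (simp add: algebra_simps)
    then have "q (c *\<^sub>R v + (c * t) *\<^sub>R v\<^sub>0) - (c * t) * q v\<^sub>0 \<le> c * r"
      unfolding t(2) by (simp add: right_diff_distrib)
    then show "\<exists>z\<in>R (c *\<^sub>R v). z \<le> c * r"
      unfolding R_def using t c by (intro bexI) (auto intro!: exI[of _ "c * t"])
  qed
  moreover have "Inf (R v) \<le> q v" for v
    by (rule cInf_lower[OF _ bdd]) (auto simp: R_def intro!: exI[of _ 0])
  moreover have "Inf (R (- v\<^sub>0)) \<le> - q v\<^sub>0"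
    by (rule cInf_lower[OF _ bdd])
      (auto simp: R_def sublinear_zero[OF q] intro!: exI[of _ 1])
  ultimately show ?thesis
    using that[of "\<lambda>v. Inf (R v)"] by (auto simp: le_fun_def)
qed

text \<open>Zorn's lemma: the pointwise infimum of a chain stays subadditive because two members of
  the chain can be replaced by the smaller one.\<close>

lemma sublinear_minimal:
  assumes q: "sublinear (q :: 'v::real_vector \<Rightarrow> real)"
  obtains m where "sublinear m" "m \<le> q" "\<And>k. sublinear k \<Longrightarrow> k \<le> m \<Longrightarrow> k = m"
proof -
  define A where "A = {m. sublinear m \<and> m \<le> q}"
  have "\<exists>m\<in>A. \<forall>k\<in>A. k \<le> m \<longrightarrow> k = m"
  proof (rule predicate_Zorn)
    \<comment> \<open>Zorn's lemma yields maximal elements, so the pointwise order is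
      reversed.\<close>
    show "partial_order_on A (relation_of (\<lambda>x y. y \<le> x) A)"
      by (rule partial_order_on_relation_ofI) auto
    fix C assume C: "C \<in> Chains (relation_of (\<lambda>x y. y \<le> x) A)"
    then have CA: "C \<subseteq> A" and tot: "\<And>k l. k \<in> C \<Longrightarrow> l \<in> C \<Longrightarrow> k \<le> l \<or> l \<le> k"
      unfolding Chains_def relation_of_def by auto
    show "\<exists>u\<in>A. \<forall>a\<in>C. u \<le> a"
    proof (cases "C = {}")
      case True
      then show ?thesis using q unfolding A_def by auto
    next
      case False
      define R where "R v = (\<lambda>m. m v) ` C" for v
      have ne: "R v \<noteq> {}" for v using False unfolding R_def by simp
      have bdd: "bdd_below (R v)" for v
      proof (rule bdd_belowI[of _ "- q (- v)"])
        fix r assume "r \<in> R v"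
        then obtain m where m: "m \<in> C" "r = m v" unfolding R_def by blast
        then have "sublinear m" "m (- v) \<le> q (- v)"
          using CA unfolding A_def le_fun_def by auto
        then show "- q (- v) \<le> r"
          using sublinear_minus[of m v] m(2) by linarith
      qed
      have "sublinear (\<lambda>v. Inf (R v))"
      proof (rule sublinear_Inf[OF ne bdd])
        fix v w r s assume "r \<in> R v" "s \<in> R w"
        then obtain k l where kl: "k \<in> C" "r = k v" "l \<in> C" "s = l w"
          unfolding R_def by blast
        then obtain m where m: "m \<in> C" "m \<le> k" "m \<le> l"
          using tot[of k l] by blast
        then have "sublinear m" using CA unfolding A_def by blast
        then have "m (v + w) \<le> m v + m w" by (rule sublinear_add)
        also have "\<dots> \<le> r + s" using m kl by (simp add: add_mono le_funD)
        finally show "\<exists>u\<in>R (v + w). u \<le> r + s"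
          using m(1) unfolding R_def by blast
      next
        fix t :: real and v r assume t: "0 < t" and "r \<in> R v"
        then obtain m where m: "m \<in> C" "r = m v" unfolding R_def by blast
        then have "sublinear m" using CA unfolding A_def by blast
        then have "m (t *\<^sub>R v) = t * r" using sublinear_scale t m(2) by blast
        then show "\<exists>u\<in>R (t *\<^sub>R v). u \<le> t * r"
          using m(1) unfolding R_def by (metis imageI order_refl)
      qed
      moreover have low: "(\<lambda>v. Inf (R v)) \<le> m" if "m \<in> C" for m
        unfolding le_fun_def using that by (intro allI cInf_lower[OF _ bdd]) (simp add: R_def)
      moreover have "(\<lambda>v. Inf (R v)) \<le> q"
      proof -
        obtain m where m: "m \<in> C" "m \<le> q"
          using False CA unfolding A_def by blast
        show ?thesis using low[OF m(1)] m(2) by (rule order_trans)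
      qed
      ultimately have "(\<lambda>v. Inf (R v)) \<in> A" unfolding A_def by simp
      then show ?thesis using low by blast
    qed
  qed
  then obtain m where m: "m \<in> A" "\<And>k. k \<in> A \<Longrightarrow> k \<le> m \<Longrightarrow> k = m" by blast
  show ?thesis
  proof (rule that)
    show "k = m" if "sublinear k" "k \<le> m" for k
    proof (rule m(2)[OF _ that(2)])
      have "m \<le> q" using m(1) unfolding A_def by blast
      then show "k \<in> A" using that order_trans[of k m q] unfolding A_def by blast
    qed
  qed (use m(1) in \<open>auto simp: A_def\<close>)
qed

text \<open>A minimal \<open>m\<close> equals each of its tilts, hence
  \<open>m (- v) \<le> - m v\<close>. With the opposite inequality, valid for every sublinear
  functional, \<open>m\<close> is odd, and an odd sublinear functional is linear.\<close>

lemma linear_below_sublinear: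
  assumes "sublinear (q :: 'v::real_vector \<Rightarrow> real)"
  obtains f where "linear f" "f \<le> q"
proof -
  obtain m where m: "sublinear m" "m \<le> q" and min: "\<And>k. sublinear k \<Longrightarrow> k \<le> m \<Longrightarrow> k = m"
    using sublinear_minimal[OF assms] by blast
  have neg: "m (- v) = - m v" for v
  proof -
    obtain m' where "sublinear m'" "m' \<le> m" "m' (- v) \<le> - m v"
      using sublinear_tilt[OF m(1)] by blast
    then show ?thesis
      using min[of m'] sublinear_minus[OF m(1), of v] by simp
  qed
  have "linear m"
  proof (rule linearI)
    fix v w
    show "m (v + w) = m v + m w"
      using sublinear_add[OF m(1), of v w] sublinear_add[OF m(1), of "- v" "- w"]
        neg[of v] neg[of w] neg[of "v + w"] by simp
    fix t :: real
    consider "t = 0" | "t > 0" | "- t > 0" by linarith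
    then show "m (t *\<^sub>R v) = t *\<^sub>R m v"
    proof cases
      case 3
      then show ?thesis
        using sublinear_scale[OF m(1) 3, of v] neg[of "t *\<^sub>R v"] by simp
    qed (use sublinear_scale[OF m(1)] sublinear_zero[OF m(1)] in auto)
  qed
  then show ?thesis using m(2) that by blast
qed

section \<open>Bounded functionals and support functionals\<close>

lemma blinfun_of_le_norm:
  fixes f :: "'v::real_normed_vector \<Rightarrow> real"
  assumes f: "linear f" and le: "\<And>v. f v \<le> norm v"
  obtains F where "blinfun_apply F = f" "norm F \<le> 1"
proof -
  have abs: "\<bar>f v\<bar> \<le> norm v" for v
    using le[of v] le[of "- v"] linear_neg[OF f, of v] by simp
  then have bl: "bounded_linear f"
    using f by (intro bounded_linear_intro[of f 1])
      (auto simp: linear_add linear_scale)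
  then have app: "blinfun_apply (Blinfun f) = f"
    by (rule bounded_linear_Blinfun_apply)
  moreover have "norm (Blinfun f) \<le> 1"
    by (rule norm_blinfun_bound) (simp_all add: app abs)
  ultimately show ?thesis by (rule that)
qed

text \<open>Work below the distance \<open>q\<close> to the line spanned by \<open>a\<close>.
  Orthogonality says that \<open>q y\<close> is still \<open>norm y\<close>, while \<open>q\<close>
  is at most 0 at \<open>a\<close> and \<open>- a\<close>, so any linear functional below
  \<open>q\<close> vanishes at \<open>a\<close>.\<close>

lemma support_functional_annihilating:
  fixes y a :: "'v::real_normed_vector"
  assumes orth: "\<And>l::real. norm y \<le> norm (y + l *\<^sub>R a)"
  obtains F :: "'v \<Rightarrow>\<^sub>L real" where "norm F \<le> 1" "F y = norm y" "F a = 0"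
proof -
  define R where "R v = range (\<lambda>l::real. norm (v + l *\<^sub>R a))" for v
  define q where "q = (\<lambda>v. Inf (R v))"
  have ne: "R v \<noteq> {}" and bdd: "bdd_below (R v)" for v
    unfolding R_def by (auto intro!: bdd_belowI[of _ 0])
  have q: "sublinear q"
    unfolding q_def
  proof (rule sublinear_Inf[OF ne bdd])
    fix v w r s assume "r \<in> R v" "s \<in> R w"
    then obtain k l where "r = norm (v + k *\<^sub>R a)" "s = norm (w + l *\<^sub>R a)"
      unfolding R_def by blast
    then have "norm (v + w + (k + l) *\<^sub>R a) \<le> r + s"
      using norm_triangle_ineq[of "v + k *\<^sub>R a" "w + l *\<^sub>R a"] by (simp add: algebra_simps)
    then show "\<exists>u\<in>R (v + w). u \<le> r + s" unfolding R_def by blast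
  next
    fix t :: real and v r assume t: "0 < t" and "r \<in> R v"
    then obtain k where "r = norm (v + k *\<^sub>R a)" unfolding R_def by blast
    then have "norm (t *\<^sub>R v + (t * k) *\<^sub>R a) \<le> t * r"
      using t norm_scaleR[of t "v + k *\<^sub>R a"] by (simp add: algebra_simps)
    then show "\<exists>u\<in>R (t *\<^sub>R v). u \<le> t * r" unfolding R_def by blast
  qed
  \<comment> \<open>Tilting at \<open>y\<close> before extracting a linear functional fixes its
    value there: \<open>f (- y) \<le> - q y\<close> makes \<open>f y\<close> at least
    \<open>norm y\<close>.\<close>
  obtain q' where q': "sublinear q'" "q' \<le> q" "q' (- y) \<le> - q y"
    using sublinear_tilt[OF q] by blast
  obtain f where f: "linear f" "f \<le> q'"
    using linear_below_sublinear[OF q'(1)] by blast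
  have fq: "f v \<le> q v" for v using f(2) q'(2) by (meson le_funD order_trans)
  have q_le: "q v \<le> norm (v + l *\<^sub>R a)" for v l
    unfolding q_def by (rule cInf_lower[OF _ bdd]) (simp add: R_def)
  have f_norm: "f v \<le> norm v" for v
    using fq[of v] q_le[of v 0] by simp
  have "norm y \<le> q y"
    unfolding q_def by (rule cInf_greatest[OF ne]) (use orth in \<open>auto simp: R_def\<close>)
  moreover have "f (- y) \<le> - q y" using f(2) q'(3) by (meson le_funD order_trans)
  ultimately have "f y = norm y"
    using f_norm[of y] linear_neg[OF f(1), of y] by linarith
  moreover have "f a = 0"
    using fq[of a] fq[of "- a"] q_le[of a "- 1"] q_le[of "- a" 1] linear_neg[OF f(1), of a] by simp
  moreover obtain F where "blinfun_apply F = f" "norm F \<le> 1"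
    using blinfun_of_le_norm[OF f(1) f_norm] by blast
  ultimately show ?thesis using that[of F] by simp
qed

lemma support_functional:
  fixes y :: "'v::real_normed_vector"
  obtains F :: "'v \<Rightarrow>\<^sub>L real" where "norm F \<le> 1" "F y = norm y"
  using support_functional_annihilating[of y 0] by auto

lemma eq_if_functionals_eq:
  fixes y z :: "'v::real_normed_vector"
  assumes "\<And>F :: 'v \<Rightarrow>\<^sub>L real. F y = F z"
  shows "y = z"
proof -
  obtain F :: "'v \<Rightarrow>\<^sub>L real" where "F (y - z) = norm (y - z)"
    using support_functional by blast
  then show ?thesis using assms[of F] by (simp add: blinfun.diff_right)
qed

lemma apply_le_norm:
  fixes F :: "'v::real_normed_vector \<Rightarrow>\<^sub>L real"
  assumes "norm F \<le> 1"
  shows "\<bar>F v\<bar> \<le> norm v"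
  using norm_blinfun[of F v] mult_right_mono[OF assms norm_ge_zero[of v]] by simp

section \<open>Semi-inner-products\<close>

text \<open>A choice of one support functional per line through the origin defines a
  semi-inner-product. On the line of \<open>y\<close> the choice can be a functional vanishing at
  \<open>a\<close>.\<close>

lemma semi_inner_product_annihilating:
  fixes y a :: "'v::real_normed_vector"
  assumes orth: "\<And>l::real. norm y \<le> norm (y + l *\<^sub>R a)"
  obtains p where "p \<in> semi_inner_products" "p a y = 0"
proof -
  \<comment> \<open>Vanishing at \<open>a\<close> is required for both unit vectors on the line of
    \<open>y\<close>, since either may become its representative.\<close>
  have "\<exists>F :: 'v \<Rightarrow>\<^sub>L real. norm F \<le> 1 \<and> blinfun_apply F v = norm v \<and>
      (v \<in> {sgn y, - sgn y} \<longrightarrow> blinfun_apply F a = 0)" for v :: 'v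
  proof (cases "v \<in> {sgn y, - sgn y}")
    case True
    have sgn_orth: "norm (sgn y) \<le> norm (sgn y + l *\<^sub>R a)" for l
    proof (cases "y = 0")
      case False
      have "y + (l * norm y) *\<^sub>R a = norm y *\<^sub>R (sgn y + l *\<^sub>R a)"
        using False by (simp add: sgn_div_norm algebra_simps)
      then have "norm y \<le> norm y * norm (sgn y + l *\<^sub>R a)"
        using orth[of "l * norm y"] by (metis abs_norm_cancel norm_scaleR)
      then show ?thesis using False by (simp add: norm_sgn)
    qed simp
    have "norm v \<le> norm (v + l *\<^sub>R a)" for l
      using True sgn_orth[of l] sgn_orth[of "- l"] norm_minus_commute[of "sgn y" "l *\<^sub>R a"]
      by (auto simp: algebra_simps)
    then show ?thesis using support_functional_annihilating by metis
  next
    case False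
    then show ?thesis using support_functional by metis
  qed
  then obtain F :: "'v \<Rightarrow> 'v \<Rightarrow>\<^sub>L real" where F: "\<And>v. norm (F v) \<le> 1" "\<And>v. blinfun_apply (F v) v = norm v"
    and Fa: "\<And>v. v \<in> {sgn y, - sgn y} \<Longrightarrow> blinfun_apply (F v) a = 0"
    by metis
  \<comment> \<open>One representative per line, so that homogeneity in the second argument is automatic.\<close>
  define e where "e w = (SOME v. v \<in> {sgn w, - sgn w})" for w :: 'v
  define p where "p u w = blinfun_apply (F (e w)) u * blinfun_apply (F (e w)) w" for u w
  have e: "e w \<in> {sgn w, - sgn w}" for w
    unfolding e_def by (rule someI_ex) auto
  have "p u (c *\<^sub>R w) = c * p u w" for c u w
  proof (cases "c = 0")
    case False
    then have "{sgn (c *\<^sub>R w), - sgn (c *\<^sub>R w)} = {sgn w, - sgn w}"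
      by (cases "c > 0") (auto simp: sgn_scaleR)
    then have "e (c *\<^sub>R w) = e w" unfolding e_def by simp
    then show ?thesis unfolding p_def by (simp add: blinfun.scaleR_right)
  qed (simp add: p_def)
  moreover have pp: "p w w = (norm w)\<^sup>2" for w
  proof -
    \<comment> \<open>The representative may point opposite to \<open>w\<close>; the sign then
      occurs in both factors of \<open>p w w\<close> and cancels.\<close>
    have "w = norm w *\<^sub>R e w \<or> w = - (norm w *\<^sub>R e w)"
      using e[of w] by (cases "w = 0") (auto simp: sgn_div_norm)
    moreover have "norm w * norm (e w) = norm w"
      using e[of w] by (cases "w = 0") (auto simp: norm_sgn)
    ultimately have "blinfun_apply (F (e w)) w = norm w \<or> blinfun_apply (F (e w)) w = - norm w"
      using F(2)[of "e w"] by (metis blinfun.minus_right blinfun.scaleR_right real_scaleR_def)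
    then show ?thesis unfolding p_def by (auto simp: power2_eq_square)
  qed
  moreover have "\<bar>p u w\<bar>\<^sup>2 \<le> p u u * p w w" for u w
  proof -
    have "\<bar>p u w\<bar> \<le> norm u * norm w"
      unfolding p_def abs_mult by (intro mult_mono apply_le_norm F) auto
    then show ?thesis unfolding pp by (metis abs_ge_zero power_mono power_mult_distrib)
  qed
  moreover have "p (\<alpha> *\<^sub>R u + \<beta> *\<^sub>R v) w = \<alpha> * p u w + \<beta> * p v w" for \<alpha> \<beta> u v w
    unfolding p_def by (simp add: blinfun.add_right blinfun.scaleR_right algebra_simps)
  ultimately have "p \<in> semi_inner_products"
    unfolding semi_inner_products_def by auto
  moreover have "p a y = 0"
    unfolding p_def using Fa[OF e] by simp
  ultimately show ?thesis by (rule that)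
qed

lemma semi_inner_product_abs_le:
  assumes "p \<in> semi_inner_products"
  shows "\<bar>p x y\<bar> \<le> norm x * norm y"
proof (rule power2_le_imp_le)
  show "\<bar>p x y\<bar>\<^sup>2 \<le> (norm x * norm y)\<^sup>2"
    using assms unfolding semi_inner_products_def power_mult_distrib mem_Collect_eq by metis
qed simp

lemma semi_inner_product_diff_left:
  assumes "p \<in> semi_inner_products"
  shows "p (u - v) w = p u w - p v w"
proof -
  have "p (1 *\<^sub>R u + (-1) *\<^sub>R v) w = 1 * p u w + (-1) * p v w"
    using assms unfolding semi_inner_products_def by blast
  then show ?thesis by simp
qed

section \<open>Best approximation in finite-dimensional subspaces\<close>

text \<open>Induction on \<open>B\<close>: a new \<open>b\<close> outside \<open>span B\<close> has
  positive distance \<open>d\<close> from it. This bounds the coefficient of \<open>b\<close> on a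
  ball, which is then a closed part of a continuous image of a compact product.\<close>

lemma compact_span_Int_cball:
  fixes B :: "'v::real_normed_vector set"
  assumes "finite B"
  shows "compact (span B \<inter> cball 0 r)"
  using assms
proof (induction B arbitrary: r rule: finite_induct)
  case empty
  have "{0} \<inter> cball 0 r = {} \<or> {0} \<inter> cball 0 r = {0::'v}" by auto
  then show ?case by auto
next
  case (insert b B)
  show ?case
  proof (cases "b \<in> span B")
    case True
    then show ?thesis using insert.IH by (simp add: span_redundant)
  next
    case False
    have "\<exists>d>0. \<forall>w\<in>span B. d \<le> norm (b + w)"
    proof (rule ccontr)
      assume "\<not> ?thesis"
      then have near: "\<exists>w\<in>span B. norm (b + w) < d" if "0 < d" for d
        using that by (meson not_le)
      \<comment> \<open>Vectors of \<open>span B\<close> within distance 1 of \<open>b\<close> have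
        norm at most \<open>norm b + 1\<close>, so the compact, hence closed, piece from the
        induction hypothesis would contain \<open>b\<close>.\<close>
      have "b \<in> closure (span B \<inter> cball 0 (norm b + 1))"
        unfolding closure_approachable
      proof (intro allI impI)
        fix d :: real assume "0 < d"
        then obtain w where w: "w \<in> span B" "norm (b + w) < min d 1"
          using near[of "min d 1"] by auto
        have "norm w \<le> norm b + 1"
          using w(2) norm_triangle_ineq4[of "b + w" b] by simp
        moreover have "dist (- w) b < d"
          using w(2) by (simp add: dist_norm norm_minus_commute add.commute)
        ultimately show "\<exists>y\<in>span B \<inter> cball 0 (norm b + 1). dist y b < d"
          using w(1) by (intro bexI[of _ "- w"]) (auto simp: span_neg)
      qed
      then show False
        using False insert.IH compact_imp_closed closure_closed by blast
    qed
    then obtain d where d: "0 < d" "\<And>w. w \<in> span B \<Longrightarrow> d \<le> norm (b + w)" by blast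
    \<comment> \<open>If \<open>t *\<^sub>R b + w\<close> has norm at most \<open>r\<close>, then
      \<open>\<bar>t\<bar> * d \<le> r\<close>, and the triangle inequality bounds
      \<open>norm w\<close> by the second radius.\<close>
    define K where "K = (\<lambda>(t, w). t *\<^sub>R b + w) `
      ({- (r / d)..r / d} \<times> (span B \<inter> cball 0 (r + r / d * norm b)))"
    have "compact K"
      unfolding K_def case_prod_beta
      by (intro compact_continuous_image compact_Times insert.IH continuous_intros) auto
    moreover have "span (insert b B) \<inter> cball 0 r = K \<inter> (cball 0 r)"
    proof (intro subset_antisym subsetI)
      fix v assume v: "v \<in> span (insert b B) \<inter> cball 0 r"
      then obtain t where t: "v - t *\<^sub>R b \<in> span B" using span_breakdown_eq by blast
      have nv: "norm v \<le> r" using v by simp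
      have td: "\<bar>t\<bar> * d \<le> norm v"
      proof (cases "t = 0")
        case False
        have "v = t *\<^sub>R (b + (1 / t) *\<^sub>R (v - t *\<^sub>R b))"
          using False by (simp add: algebra_simps)
        then have "norm v = \<bar>t\<bar> * norm (b + (1 / t) *\<^sub>R (v - t *\<^sub>R b))"
          by (metis norm_scaleR)
        then show ?thesis using d(2)[OF span_scale[OF t, of "1 / t"]]
          by (simp add: mult_left_mono)
      qed simp
      then have tr: "\<bar>t\<bar> \<le> r / d"
        using nv d(1) by (simp add: pos_le_divide_eq)
      have "norm (v - t *\<^sub>R b) \<le> norm v + \<bar>t\<bar> * norm b"
        using norm_triangle_ineq4[of v "t *\<^sub>R b"] by simp
      also have "\<dots> \<le> r + r / d * norm b"
        using nv tr by (intro add_mono mult_right_mono) auto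
      finally have "(t, v - t *\<^sub>R b) \<in>
          {- (r / d)..r / d} \<times> (span B \<inter> cball 0 (r + r / d * norm b))"
        using tr t by auto
      then show "v \<in> K \<inter> cball 0 r"
        unfolding K_def using v by (auto intro!: image_eqI[of _ _ "(t, v - t *\<^sub>R b)"])
    next
      fix v assume v: "v \<in> K \<inter> cball 0 r"
      then obtain t w where "v = t *\<^sub>R b + w" "w \<in> span B" unfolding K_def by auto
      then have "v - t *\<^sub>R b \<in> span B" by simp
      then show "v \<in> span (insert b B) \<inter> cball 0 r"
        using v span_breakdown_eq by blast
    qed
    ultimately show ?thesis by (simp add: compact_Int_closed)
  qed
qed

text \<open>Minimise over the compact ball of radius \<open>2 * norm T\<close> in \<open>Z\<close>.
  Elements outside it are farther from \<open>T\<close> than 0 is, and 0 lies in the ball.\<close>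

lemma best_approximation_exists:
  fixes Z :: "'v::real_normed_vector set"
  assumes "finite_dim_subspace Z"
  obtains A where "best_approximation Z T A"
proof -
  obtain B where Z: "subspace Z" "finite B" "span B = Z"
    using assms unfolding finite_dim_subspace_def by blast
  have 0: "0 \<in> Z" using Z(1) by (rule subspace_0)
  have "compact (Z \<inter> cball 0 (2 * norm T))"
    using compact_span_Int_cball Z(2,3) by blast
  moreover have "0 \<in> Z \<inter> cball 0 (2 * norm T)" using 0 by simp
  ultimately obtain A where A: "A \<in> Z" and
    min: "\<And>C. C \<in> Z \<Longrightarrow> norm C \<le> 2 * norm T \<Longrightarrow> dist T A \<le> dist T C"
    using continuous_attains_inf[of "Z \<inter> cball 0 (2 * norm T)" "dist T",
        OF _ _ continuous_on_dist[OF continuous_on_const continuous_on_id]]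
    by (metis IntD1 IntI empty_iff mem_cball_0)
  have "dist T A \<le> dist T C" if "C \<in> Z" for C
  proof (cases "norm C \<le> 2 * norm T")
    case False
    have "norm C \<le> norm T + dist T C"
      using norm_triangle_ineq2[of C T] by (simp add: dist_norm norm_minus_commute)
    then show ?thesis using min[OF 0] False by simp
  qed (use min that in blast)
  then have "dist T A \<le> infdist T Z"
    using 0 by (auto simp: infdist_def intro!: cINF_greatest)
  then have "dist T A = infdist T Z"
    using infdist_le[OF A, of T] by simp
  then show ?thesis using A that unfolding best_approximation_def by blast
qed

section \<open>Orthogonality of operators\<close>

text \<open>
  Weak sequential compactness is replaced by a linear functional below the upper limit of
  \<open>F (x n)\<close> on the dual, which reflexivity turns into a point of \<open>'a\<close>.
\<close>

lemma reflexive_weak_limit: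
  fixes x :: "nat \<Rightarrow> 'a::real_normed_vector"
  assumes refl: "reflexive_space TYPE('a)" and x: "\<And>n. norm (x n) \<le> 1"
  obtains x\<^sub>0 where "norm x\<^sub>0 \<le> 1"
    "\<And>(F :: 'a \<Rightarrow>\<^sub>L real) c. (\<lambda>n. F (x n)) \<longlonglongrightarrow> c \<Longrightarrow> F x\<^sub>0 = c"
proof -
  \<comment> \<open>These are the eventual upper bounds, so their infimum \<open>q F\<close> is the
    upper limit of \<open>F (x n)\<close>.\<close>
  define R where "R F = {r. \<forall>\<^sub>F n in sequentially. blinfun_apply F (x n) \<le> r}"
    for F :: "'a \<Rightarrow>\<^sub>L real"
  define q where "q = (\<lambda>F. Inf (R F))"
  have Fx: "\<bar>F (x n)\<bar> \<le> norm F" for F :: "'a \<Rightarrow>\<^sub>L real" and n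
    using norm_blinfun[of F "x n"] mult_left_mono[OF x norm_ge_zero[of F], of n] by simp
  have norm_R: "norm F \<in> R F" for F
    unfolding R_def using Fx[of F] by (auto simp: abs_le_iff)
  then have ne: "R F \<noteq> {}" for F by blast
  have bdd: "bdd_below (R F)" for F
  proof (rule bdd_belowI[of _ "- norm F"])
    fix r assume "r \<in> R F"
    then obtain n where "F (x n) \<le> r"
      unfolding R_def using eventually_happens'[OF sequentially_bot] by blast
    then show "- norm F \<le> r" using Fx[of F n] by linarith
  qed
  have q: "sublinear q"
    unfolding q_def
  proof (rule sublinear_Inf[OF ne bdd])
    fix F G r s assume "r \<in> R F" "s \<in> R G"
    then have "r + s \<in> R (F + G)"
      unfolding R_def mem_Collect_eq
      by (rule eventually_elim2) (simp add: blinfun.add_left)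
    then show "\<exists>u\<in>R (F + G). u \<le> r + s" by blast
  next
    fix t :: real and F r assume t: "0 < t" and "r \<in> R F"
    then have "t * r \<in> R (t *\<^sub>R F)"
      unfolding R_def by (auto elim!: eventually_mono simp: blinfun.scaleR_left)
    then show "\<exists>u\<in>R (t *\<^sub>R F). u \<le> t * r" by blast
  qed
  obtain f where f: "linear f" "f \<le> q"
    using linear_below_sublinear[OF q] by blast
  have fR: "f F \<le> r" if "r \<in> R F" for F r
    using f(2) cInf_lower[OF that bdd] unfolding q_def le_fun_def by (meson order_trans)
  \<comment> \<open>Since \<open>norm F\<close> is itself an eventual upper bound, \<open>f\<close>
    lies below the dual norm and is an element of the bidual.\<close>
  obtain \<phi> where \<phi>: "blinfun_apply \<phi> = f"
    using blinfun_of_le_norm[OF f(1) fR[OF norm_R]] by blast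
  obtain x\<^sub>0 where x\<^sub>0: "\<And>F :: 'a \<Rightarrow>\<^sub>L real. f F = F x\<^sub>0"
    using refl \<phi> unfolding reflexive_space_def by metis
  have upper: "F x\<^sub>0 \<le> c" if "(\<lambda>n. F (x n)) \<longlonglongrightarrow> c" for F :: "'a \<Rightarrow>\<^sub>L real" and c
  proof (rule field_le_epsilon)
    fix d :: real assume "0 < d"
    then have "\<forall>\<^sub>F n in sequentially. F (x n) < c + d"
      using order_tendstoD(2)[OF that, of "c + d"] by simp
    then have "c + d \<in> R F"
      unfolding R_def by (auto elim: eventually_mono)
    then show "F x\<^sub>0 \<le> c + d" using fR x\<^sub>0 by metis
  qed
  have "F x\<^sub>0 = c" if "(\<lambda>n. F (x n)) \<longlonglongrightarrow> c" for F :: "'a \<Rightarrow>\<^sub>L real" and c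
  proof -
    have "(\<lambda>n. (- F) (x n)) \<longlonglongrightarrow> - c"
      using tendsto_minus[OF that] by (simp add: blinfun.minus_left)
    then show ?thesis
      using upper[OF that] upper[of "- F" "- c"] by (simp add: blinfun.minus_left)
  qed
  moreover have "norm x\<^sub>0 \<le> 1"
  proof -
    obtain F :: "'a \<Rightarrow>\<^sub>L real" where F: "norm F \<le> 1" "F x\<^sub>0 = norm x\<^sub>0"
      using support_functional by blast
    then show ?thesis using fR[OF norm_R, of F] x\<^sub>0[of F] by simp
  qed
  ultimately show ?thesis using that by blast
qed

text \<open>The norm is convex along a line: starting at most at \<open>c\<close> and having reached
  \<open>c\<close> at \<open>s\<close>, it cannot fall below \<open>c\<close> afterwards.\<close>

lemma norm_ge_beyond:
  fixes u v :: "'v::real_normed_vector"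
  assumes "norm u \<le> c" "c \<le> norm (u + s *\<^sub>R v)" "0 < s" "s \<le> t"
  shows "c \<le> norm (u + t *\<^sub>R v)"
proof -
  have "u + s *\<^sub>R v = (1 - s / t) *\<^sub>R u + (s / t) *\<^sub>R (u + t *\<^sub>R v)"
    using assms(3,4) by (simp add: algebra_simps)
  then have "norm (u + s *\<^sub>R v) \<le> norm ((1 - s / t) *\<^sub>R u) + norm ((s / t) *\<^sub>R (u + t *\<^sub>R v))"
    by (metis norm_triangle_ineq)
  also have "\<dots> = (1 - s / t) * norm u + (s / t) * norm (u + t *\<^sub>R v)"
    using assms(3,4) by (simp add: abs_of_nonneg)
  also have "\<dots> \<le> (1 - s / t) * c + (s / t) * norm (u + t *\<^sub>R v)"
    using assms by (intro add_mono mult_left_mono) auto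
  finally have "(s / t) * c \<le> (s / t) * norm (u + t *\<^sub>R v)"
    using assms(2) by (simp add: algebra_simps)
  then show ?thesis
    using assms(3,4) by (subst (asm) mult_le_cancel_left_pos) auto
qed

text \<open>The one-sided Bhatia-Semrl property.\<close>

lemma norm_attainment_one_sided:
  fixes T A :: "'a::real_normed_vector \<Rightarrow>\<^sub>L 'b::real_normed_vector" and c :: real
  assumes refl: "reflexive_space TYPE('a)"
    and T: "T \<in> compact_operators" and A: "A \<in> compact_operators"
    and S: "S = T - A" "S \<noteq> 0"
    and orth: "\<And>l. norm S \<le> norm (S + l *\<^sub>R A)"
    and attain: "\<And>l. norm_attainment_set (S + l *\<^sub>R A) \<noteq> {}"
  obtains x where "x \<in> norm_attainment_set S"
    "\<And>l. 0 \<le> l \<Longrightarrow> norm S \<le> norm (S x + (l * c) *\<^sub>R A x)"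
proof -
  \<comment> \<open>The sign of \<open>c\<close> selects the side from which the perturbations
    approach \<open>S\<close>; later \<open>c\<close> is 1 or -1.\<close>
  have "\<exists>x. \<forall>n. x n \<in> norm_attainment_set (S + (c / real (Suc n)) *\<^sub>R A)"
    using attain by (intro choice) blast
  then obtain x where x: "\<And>n. norm (x n) = 1"
    "\<And>n. norm ((S + (c / real (Suc n)) *\<^sub>R A) (x n)) = norm (S + (c / real (Suc n)) *\<^sub>R A)"
    unfolding norm_attainment_set_def by auto
  have Tx: "T (x n) \<in> closure (T ` cball 0 1)" and Ax: "A (x n) \<in> closure (A ` cball 0 1)" for n
    using x(1) by (auto intro!: subsetD[OF closure_subset])
  obtain s r where r: "strict_mono r" and s: "(\<lambda>n. T (x (r n))) \<longlonglongrightarrow> s"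
    using T Tx unfolding compact_operators_def compact_def o_def mem_Collect_eq by meson
  obtain a r' where r': "strict_mono r'" and a: "(\<lambda>n. A (x (r (r' n)))) \<longlonglongrightarrow> a"
    using A Ax unfolding compact_operators_def compact_def o_def mem_Collect_eq by meson
  define k where "k n = r (r' n)" for n
  have k: "strict_mono k" using strict_mono_o[OF r r'] unfolding k_def o_def .
  have Tk: "(\<lambda>n. T (x (k n))) \<longlonglongrightarrow> s"
    using LIMSEQ_subseq_LIMSEQ[OF s r'] unfolding k_def o_def .
  have Ak: "(\<lambda>n. A (x (k n))) \<longlonglongrightarrow> a"
    using a unfolding k_def .
  obtain x\<^sub>0 where x\<^sub>0: "norm x\<^sub>0 \<le> 1"
    "\<And>(F :: 'a \<Rightarrow>\<^sub>L real) d. (\<lambda>n. F (x (k n))) \<longlonglongrightarrow> d \<Longrightarrow> F x\<^sub>0 = d"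
    using reflexive_weak_limit[OF refl, of "\<lambda>n. x (k n)"] x(1) by (metis order_refl)
  \<comment> \<open>Composing with functionals on the target identifies a norm limit of the images
    with the image of the weak limit; compactness supplies the norm limits for \<open>T\<close> and
    \<open>A\<close>.\<close>
  have lim: "B x\<^sub>0 = b" if "(\<lambda>n. B (x (k n))) \<longlonglongrightarrow> b" for B :: "'a \<Rightarrow>\<^sub>L 'b" and b
  proof (rule eq_if_functionals_eq)
    fix F :: "'b \<Rightarrow>\<^sub>L real"
    have "(\<lambda>n. (F o\<^sub>L B) (x (k n))) \<longlonglongrightarrow> F b"
      using that by (auto intro: blinfun.tendsto)
    then show "F (B x\<^sub>0) = F b"
      using x\<^sub>0(2)[of "F o\<^sub>L B"] by simp
  qed
  have Ax\<^sub>0: "(\<lambda>n. A (x (k n))) \<longlonglongrightarrow> A x\<^sub>0" using lim[OF Ak] Ak by simp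
  have Sx\<^sub>0: "(\<lambda>n. S (x (k n))) \<longlonglongrightarrow> S x\<^sub>0"
    using tendsto_diff[OF Tk Ak] lim[OF Tk] lim[OF Ak] by (simp add: S(1) blinfun.diff_left)
  \<comment> \<open>For fixed \<open>l\<close>, eventually \<open>1 / Suc (k n)\<close> is below
    \<open>l\<close>. At that smaller parameter \<open>x (k n)\<close> attains the norm of the
    perturbed operator, which is at least \<open>norm S\<close>; convexity carries the bound to
    \<open>l\<close>, and the limit preserves it.\<close>
  have pos: "norm S \<le> norm (S x\<^sub>0 + l *\<^sub>R (c *\<^sub>R A x\<^sub>0))" if "0 < l" for l
  proof (rule tendsto_lowerbound)
    show "(\<lambda>n. norm (S (x (k n)) + l *\<^sub>R (c *\<^sub>R A (x (k n))))) \<longlonglongrightarrow>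
        norm (S x\<^sub>0 + l *\<^sub>R (c *\<^sub>R A x\<^sub>0))"
      by (intro tendsto_intros Sx\<^sub>0 Ax\<^sub>0)
    have "(\<lambda>n. 1 / real (Suc (k n))) \<longlonglongrightarrow> 0"
      using LIMSEQ_subseq_LIMSEQ[OF LIMSEQ_Suc[OF lim_1_over_n] k] unfolding o_def by simp
    then have "\<forall>\<^sub>F n in sequentially. 1 / real (Suc (k n)) < l"
      using that by (rule order_tendstoD)
    then show "\<forall>\<^sub>F n in sequentially. norm S \<le> norm (S (x (k n)) + l *\<^sub>R (c *\<^sub>R A (x (k n))))"
    proof (rule eventually_mono)
      fix n assume n: "1 / real (Suc (k n)) < l"
      show "norm S \<le> norm (S (x (k n)) + l *\<^sub>R (c *\<^sub>R A (x (k n))))"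
      proof (rule norm_ge_beyond)
        show "norm (S (x (k n))) \<le> norm S"
          using norm_blinfun[of S "x (k n)"] x(1) by simp
        show "norm S \<le> norm (S (x (k n)) + (1 / real (Suc (k n))) *\<^sub>R (c *\<^sub>R A (x (k n))))"
          using orth[of "c / real (Suc (k n))"] x(2)[of "k n"]
          by (simp add: blinfun.add_left blinfun.scaleR_left)
      qed (use n in auto)
    qed
  qed simp
  \<comment> \<open>Letting \<open>l\<close> decrease to 0 shows that \<open>x\<^sub>0\<close>
    attains the norm. As \<open>S\<close> is nonzero and \<open>norm x\<^sub>0 \<le> 1\<close>, it
    is a unit vector.\<close>
  have "norm S \<le> norm (S x\<^sub>0)"
  proof (rule tendsto_lowerbound)
    have "((\<lambda>l. norm (S x\<^sub>0 + l *\<^sub>R (c *\<^sub>R A x\<^sub>0))) \<longlongrightarrow> norm (S x\<^sub>0 + 0 *\<^sub>R (c *\<^sub>R A x\<^sub>0))) (at_right 0)"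
      by (intro tendsto_intros)
    then show "((\<lambda>l. norm (S x\<^sub>0 + l *\<^sub>R (c *\<^sub>R A x\<^sub>0))) \<longlongrightarrow> norm (S x\<^sub>0)) (at_right 0)" by simp
    show "\<forall>\<^sub>F l in at_right 0. norm S \<le> norm (S x\<^sub>0 + l *\<^sub>R (c *\<^sub>R A x\<^sub>0))"
      using pos by (auto intro!: eventually_at_rightI[of 0 1])
  qed simp
  moreover have "norm (S x\<^sub>0) \<le> norm S * norm x\<^sub>0" by (rule norm_blinfun)
  moreover have "norm S * norm x\<^sub>0 \<le> norm S"
    using mult_left_mono[OF x\<^sub>0(1) norm_ge_zero[of S]] by simp
  ultimately have eq: "norm (S x\<^sub>0) = norm S" "norm S * norm x\<^sub>0 = norm S" by linarith+
  then have "norm x\<^sub>0 = 1" using S(2) by simp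
  then have "x\<^sub>0 \<in> norm_attainment_set S"
    unfolding norm_attainment_set_def using eq by simp
  moreover have "norm S \<le> norm (S x\<^sub>0 + (l * c) *\<^sub>R A x\<^sub>0)" if "0 \<le> l" for l
    using pos[of l] eq(1) that by (cases "l = 0") auto
  ultimately show ?thesis by (rule that)
qed

lemma norm_attainment_orthogonal:
  fixes T A :: "'a::real_normed_vector \<Rightarrow>\<^sub>L 'b::real_normed_vector"
  assumes refl: "reflexive_space TYPE('a)"
    and T: "T \<in> compact_operators" and A: "A \<in> compact_operators"
    and S: "S = T - A" "S \<noteq> 0"
    and orth: "\<And>l. norm S \<le> norm (S + l *\<^sub>R A)"
    and attain: "\<And>l. norm_attainment_set (S + l *\<^sub>R A) \<noteq> {}"
    and D: "connected D" "norm_attainment_set S = D \<union> uminus ` D"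
  obtains x where "x \<in> norm_attainment_set S" "\<And>l. norm (S x) \<le> norm (S x + l *\<^sub>R A x)"
proof -
  define P where "P c = {x. \<forall>l\<ge>0. norm S \<le> norm (S x + (l * c) *\<^sub>R A x)}" for c :: real
  have closed: "closed (P c)" for c
  proof -
    have "P c = (\<Inter>l\<in>{0..}. {x. norm S \<le> norm (S x + (l * c) *\<^sub>R A x)})"
      unfolding P_def by auto
    also have "closed \<dots>"
      by (intro closed_INT ballI closed_Collect_le continuous_intros)
    finally show ?thesis .
  qed
  have sym: "- x \<in> P c" if "x \<in> P c" for x c
  proof -
    have "norm (S (- x) + (l * c) *\<^sub>R A (- x)) = norm (S x + (l * c) *\<^sub>R A x)" for l
      using norm_minus_cancel[of "S x + (l * c) *\<^sub>R A x"] by (simp add: blinfun.minus_right)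
    then show ?thesis using that unfolding P_def by simp
  qed
  \<comment> \<open>The one-sided point may lie in \<open>- D\<close>; symmetry of
    \<open>P c\<close> moves it into \<open>D\<close>.\<close>
  have meets: "D \<inter> P c \<noteq> {}" for c
  proof -
    obtain x where x: "x \<in> norm_attainment_set S" "x \<in> P c"
      using norm_attainment_one_sided[OF refl T A S orth attain] unfolding P_def by blast
    then have "x \<in> D \<or> - x \<in> D" using D(2) by auto
    then show ?thesis using x(2) sym by blast
  qed
  have cover: "D \<subseteq> P 1 \<union> P (- 1)"
  proof (rule subsetI, rule ccontr)
    fix x assume x: "x \<in> D" "x \<notin> P 1 \<union> P (- 1)"
    then obtain l k where lk: "0 \<le> l" "0 \<le> k"
      "norm (S x + l *\<^sub>R A x) < norm S" "norm (S x - k *\<^sub>R A x) < norm S"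
      unfolding P_def by (auto simp: not_le)
    have Sx: "norm (S x) = norm S"
      using x(1) D(2) unfolding norm_attainment_set_def by auto
    then have "0 < l" "0 < k" using lk by (auto simp: order_less_le)
    \<comment> \<open>\<open>S x\<close> is a convex combination of a point on each side of it; if
      both had norm below \<open>norm S\<close>, so would \<open>S x\<close>.\<close>
    have "(l + k) *\<^sub>R S x = k *\<^sub>R (S x + l *\<^sub>R A x) + l *\<^sub>R (S x - k *\<^sub>R A x)"
      by (simp add: algebra_simps)
    then have "norm ((l + k) *\<^sub>R S x) \<le> norm (k *\<^sub>R (S x + l *\<^sub>R A x)) + norm (l *\<^sub>R (S x - k *\<^sub>R A x))"
      by (metis norm_triangle_ineq)
    then have "(l + k) * norm S \<le> k * norm (S x + l *\<^sub>R A x) + l * norm (S x - k *\<^sub>R A x)"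
      using lk Sx by simp
    also have "\<dots> < k * norm S + l * norm S"
      using lk \<open>0 < l\<close> \<open>0 < k\<close> by (intro add_strict_mono mult_strict_left_mono) auto
    finally show False by (simp add: algebra_simps)
  qed
  have "P 1 \<inter> P (- 1) \<inter> D \<noteq> {}"
    using connected_closedD[OF D(1) _ cover closed closed] meets by blast
  then obtain x where x: "x \<in> D" "x \<in> P 1" "x \<in> P (- 1)" by blast
  have xM: "x \<in> norm_attainment_set S" using x(1) D(2) by blast
  have "norm S \<le> norm (S x + l *\<^sub>R A x)" for l
  proof (cases "0 \<le> l")
    case True
    then have "norm S \<le> norm (S x + (l * 1) *\<^sub>R A x)" using x(2) unfolding P_def by blast
    then show ?thesis by simp
  next
    case False
    then have "norm S \<le> norm (S x + (- l * - 1) *\<^sub>R A x)"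
      using x(3) unfolding P_def by (metis (mono_tags, lifting) mem_Collect_eq neg_0_le_iff_le nle_le)
    then show ?thesis by simp
  qed
  then show ?thesis
    using that[OF xM] xM unfolding norm_attainment_set_def by auto
qed

section \<open>The distance formula\<close>

theorem theorem2p10:
  fixes Z :: "('a::banach \<Rightarrow>\<^sub>L 'b::banach) set" and T :: "'a \<Rightarrow>\<^sub>L 'b"
  assumes "reflexive_space TYPE('a)"
    and "finite_dim_subspace Z" and "Z \<subseteq> compact_operators"
    and "T \<in> compact_operators - Z"
    and "\<And>(l::real) A. A \<in> Z \<Longrightarrow>
           \<exists>D. D \<noteq> {} \<and> connected D \<and> D \<subseteq> sphere 0 1 \<and>
               norm_attainment_set (T + l *\<^sub>R A) = D \<union> uminus ` D"
  shows "\<exists>A\<^sub>0\<in>Z.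
           infdist T Z =
             Sup {p (blinfun_apply T x) y | x y p.
                    x \<in> sphere 0 1 \<and> y \<in> sphere 0 1 \<and> p \<in> semi_inner_products \<and>
                    p (blinfun_apply A\<^sub>0 x) y = 0} \<and>
           best_approximation Z T A\<^sub>0"
proof -
  obtain A where best: "best_approximation Z T A"
    using best_approximation_exists[OF assms(2)] by blast
  then have A: "A \<in> Z" and dist: "dist T A = infdist T Z"
    unfolding best_approximation_def by auto
  define S where "S = T - A"
  have norm_S: "norm S = infdist T Z" using dist by (simp add: S_def dist_norm)
  have S0: "S \<noteq> 0" using assms(4) A by (auto simp: S_def)
  have Z: "subspace Z" using assms(2) unfolding finite_dim_subspace_def by blast
  \<comment> \<open>This transfers the hypothesis on \<open>T + l *\<^sub>R A\<close> to
    perturbations of \<open>S\<close>; the coefficient -1 gives \<open>S\<close> itself.\<close>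
  have shift: "S + l *\<^sub>R A = T + (l - 1) *\<^sub>R A" for l
    by (simp add: S_def algebra_simps)
  have orth: "norm S \<le> norm (S + l *\<^sub>R A)" for l
  proof -
    have "(1 - l) *\<^sub>R A \<in> Z" using Z A by (rule subspace_scale)
    then have "norm S \<le> dist T ((1 - l) *\<^sub>R A)" unfolding norm_S by (rule infdist_le)
    also have "\<dots> = norm (S + l *\<^sub>R A)" by (simp add: dist_norm S_def algebra_simps)
    finally show ?thesis .
  qed
  have attain: "norm_attainment_set (S + l *\<^sub>R A) \<noteq> {}" for l
    using assms(5)[OF A, of "l - 1"] unfolding shift by auto
  obtain D where D: "connected D" "norm_attainment_set S = D \<union> uminus ` D"
    using assms(5)[OF A, of "- 1"] shift[of 0] by auto
  obtain x where x: "x \<in> norm_attainment_set S" "\<And>l. norm (S x) \<le> norm (S x + l *\<^sub>R A x)"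
    using norm_attainment_orthogonal[OF assms(1) _ _ S_def S0 orth attain D] assms(3,4) A by blast
  then have x1: "x \<in> sphere 0 1" and Sx: "norm (S x) = norm S"
    unfolding norm_attainment_set_def by auto
  obtain p where p: "p \<in> semi_inner_products" "p (A x) (S x) = 0"
    using semi_inner_product_annihilating[OF x(2)] by blast
  \<comment> \<open>Since \<open>x\<close> attains the norm of \<open>S\<close>, this is the unit
    vector in the direction of \<open>S x\<close>; homogeneity in the second argument keeps
    \<open>p (A x) y\<close> zero.\<close>
  define y where "y = (1 / norm S) *\<^sub>R S x"
  have py: "p u y = p u (S x) / norm S" for u
  proof -
    have "p u ((1 / norm S) *\<^sub>R S x) = (1 / norm S) * p u (S x)"
      using p(1) unfolding semi_inner_products_def by blast
    then show ?thesis by (simp add: y_def)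
  qed
  have y1: "y \<in> sphere 0 1" using Sx S0 by (simp add: y_def)
  have pA: "p (A x) y = 0" using p(2) py by simp
  have "p (S x) (S x) = (norm S)\<^sup>2"
    using p(1) Sx unfolding semi_inner_products_def by auto
  then have "p (S x) y = norm S" using S0 by (simp add: py power2_eq_square)
  then have "p (T x) y = infdist T Z"
    using semi_inner_product_diff_left[OF p(1), of "T x" "A x" y] pA
    by (simp add: S_def blinfun.diff_left flip: norm_S)
  then have mem: "infdist T Z \<in> {p (blinfun_apply T x) y | x y p.
      x \<in> sphere 0 1 \<and> y \<in> sphere 0 1 \<and> p \<in> semi_inner_products \<and> p (blinfun_apply A x) y = 0}"
    using x1 y1 p(1) pA by (smt (verit, ccfv_SIG) mem_Collect_eq)
  have upper: "p (T x) y \<le> infdist T Z"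
    if "x \<in> sphere 0 1" "y \<in> sphere 0 1" "p \<in> semi_inner_products" "p (A x) y = 0" for x y p
  proof -
    have "p (T x) y = p (S x) y"
      using semi_inner_product_diff_left[OF that(3), of "T x" "A x" y] that(4)
      by (simp add: S_def blinfun.diff_left)
    also have "\<dots> \<le> norm (S x) * norm y"
      using semi_inner_product_abs_le[OF that(3), of "S x" y] by simp
    also have "\<dots> \<le> infdist T Z"
      using norm_blinfun[of S x] that(1,2) norm_S by simp
    finally show ?thesis .
  qed
  have "Sup {p (blinfun_apply T x) y | x y p.
      x \<in> sphere 0 1 \<and> y \<in> sphere 0 1 \<and> p \<in> semi_inner_products \<and>
      p (blinfun_apply A x) y = 0} = infdist T Z"
    \<comment> \<open>The supremum is a maximum: \<open>mem\<close> shows that the distance is one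
      of the values, and \<open>upper\<close> that it bounds all of them.\<close>
    by (rule cSup_eq_maximum[OF mem]) (use upper in blast)
  from this[symmetric] A best show ?thesis
    by (intro bexI[of _ A] conjI)
qed

end
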